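(* Let $\mathcal{L}=(L,\wedge,\vee,0,1)$ be a complete lattice, let $X\subseteq L\setminus\{1\}$, and assume that $\mathcal{L}$ is an $X$-top lattice. (1) There is a one-to-one correspondence between $\mathcal{C}(L)$ and the set of closed sets in $(X,\tau)$. (2) If $SI(\mathcal{C}(\mathcal{L}))\subseteq X$, then there is a one-to-one correspondence between $X$ and the set of irreducible closed sets in $(X,\tau)$. (3) If $SI(\mathcal{C}(\mathcal{L}))\subseteq X$, then there is a one-to-one correspondence between $Min(X)$ and the set of irreducible components in $(X,\tau)$.
   Context: For $a\in L$ put $V(a)=\{p\in X\mid a\le p\}$. Put $\tau=\{X\setminus V(a)\mid a\in L\}$. $\mathcal{L}$ is $X$-top iff $\{V(a)\mid a\in L\}$ is closed under finite unions (equivalently $\tau$ is a topology on $X$, whose closed sets are the $V(a)$). For $a\in L$ put $\sqrt a=\bigwedge_{p\in V(a)}p$ (empty meet equal to $1$). $\mathcal{C}(\mathcal{L})$ denotes the set $\mathcal{C}(L)=\{a\in L\mid\sqrt a=a\}$ with the induced order; it is a complete lattice with the same meets as $L$ and top $1$. $SI(\mathcal{C}(\mathcal{L}))$ is the set of strongly irreducible elements of $\mathcal{C}(\mathcal{L})$, i.e. of those $x\in\mathcal{C}(L)\setminus\{1\}$ such that for all $a,b\in\mathcal{C}(L)$ with $a\wedge b\le x$ one has $a\le x$ or $b\le x$. $Min(X)$ is the set of minimal elements of the poset $X$. A subset $A$ of a topological space is irreducible iff it is non-empty and, for any closed sets $F_1,F_2$ with $A\subseteq F_1\cup F_2$, one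 has $A\subseteq F_1$ or $A\subseteq F_2$. An irreducible component is an irreducible subset that is not a proper subset of any irreducible subset. *)

theory Defs
  imports "HOL-Analysis.Abstract_Topology"
begin

definition V :: "'a::complete_lattice set \<Rightarrow> 'a \<Rightarrow> 'a set" where
  "V X a = {p \<in> X. a \<le> p}"

definition tau :: "'a::complete_lattice set \<Rightarrow> 'a set set" where
  "tau X = {X - V X a | a. True}"

definition X_top_lattice :: "'a::complete_lattice set \<Rightarrow> bool" where
  "X_top_lattice X \<longleftrightarrow>
     (\<forall>\<F>. finite \<F> \<and> \<F> \<subseteq> {V X a | a. True} \<longrightarrow> \<Union>\<F> \<in> {V X a | a. True})"

text \<open>Only meaningful if tau X really is a topology on X; the lemmas
  openin_V_topology and closedin_V_topology below show that this is the case for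
  X-top lattices.\<close>

definition V_topology :: "'a::complete_lattice set \<Rightarrow> 'a topology" where
  "V_topology X = topology (\<lambda>U. U \<in> tau X)"

text \<open>The radical of a, written as a square root of a in the literature. If V X a is empty,
  this is top.\<close>

definition radical :: "'a::complete_lattice set \<Rightarrow> 'a \<Rightarrow> 'a" where
  "radical X a = Inf (V X a)"

definition radical_elements :: "'a::complete_lattice set \<Rightarrow> 'a set" where
  "radical_elements X = {a. radical X a = a}"

text \<open>S is the carrier of a lattice with the induced order whose binary meets and top element
  are those of the ambient lattice, as is the case for S = radical_elements X.\<close>

definition strongly_irreducible_elements :: "'a::complete_lattice set \<Rightarrow> 'a set" where
  "strongly_irreducible_elements S =
     {x \<in> S - {top}. \<forall>a\<in>S. \<forall>b\<in>S. inf a b \<le> x \<longrightarrow> a \<le> x \<or> b \<le> x}"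

definition minimal_elements :: "'a::order set \<Rightarrow> 'a set" where
  "minimal_elements S = {p \<in> S. \<forall>q\<in>S. q \<le> p \<longrightarrow> q = p}"

definition irreducible_in :: "'a topology \<Rightarrow> 'a set \<Rightarrow> bool" where
  "irreducible_in T A \<longleftrightarrow>
     A \<subseteq> topspace T \<and> A \<noteq> {} \<and>
     (\<forall>F1 F2. closedin T F1 \<and> closedin T F2 \<and> A \<subseteq> F1 \<union> F2 \<longrightarrow> A \<subseteq> F1 \<or> A \<subseteq> F2)"

definition irreducible_component_of :: "'a topology \<Rightarrow> 'a set \<Rightarrow> bool" where
  "irreducible_component_of T A \<longleftrightarrow>
     irreducible_in T A \<and> (\<nexists>B. irreducible_in T B \<and> A \<subset> B)"

lemma radical_elements_top:
  assumes "top \<notin> X"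
  shows "top \<in> radical_elements X"
proof -
  have "V X top = {}" using assms by (auto simp: V_def top_unique)
  then show ?thesis by (simp add: radical_elements_def radical_def)
qed

lemma radical_elements_Inf:
  assumes "A \<subseteq> radical_elements X"
  shows "(Inf A) \<in> radical_elements X"
proof -
  have "Inf (V X (Inf A)) \<le> a" if "a \<in> A" for a
  proof -
    have "V X a \<subseteq> V X (Inf A)" using that by (auto simp: V_def intro: Inf_lower2)
    then have "Inf (V X (Inf A)) \<le> Inf (V X a)" by (rule Inf_superset_mono)
    also have "\<dots> = a" using that assms by (auto simp: radical_elements_def radical_def)
    finally show ?thesis .
  qed
  then have "Inf (V X (Inf A)) \<le> Inf A" by (auto intro: Inf_greatest)
  moreover have "Inf A \<le> Inf (V X (Inf A))" by (rule Inf_greatest) (simp add: V_def)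
  ultimately show ?thesis by (simp add: radical_elements_def radical_def antisym)
qed

lemma V_Sup: "X - V X (Sup B) = (\<Union>b\<in>B. X - V X b)"
  by (auto simp: V_def Sup_le_iff)

lemma istopology_tau:
  assumes "X_top_lattice X"
  shows "istopology (\<lambda>U. U \<in> tau X)"
  unfolding istopology_def
proof (intro conjI allI impI)
  fix S T assume "S \<in> tau X" "T \<in> tau X"
  then obtain a b where ab: "S = X - V X a" "T = X - V X b" by (auto simp: tau_def)
  have "finite {V X a, V X b} \<and> {V X a, V X b} \<subseteq> {V X a | a. True}" by blast
  then have "\<Union>{V X a, V X b} \<in> {V X a | a. True}"
    using assms unfolding X_top_lattice_def by (elim allE) (erule mp)
  then obtain c where "V X a \<union> V X b = V X c" by auto
  then have "S \<inter> T = X - V X c" using ab by blast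
  then show "S \<inter> T \<in> tau X" by (auto simp: tau_def)
next
  fix K assume K: "\<forall>S\<in>K. S \<in> tau X"
  define B where "B = {a. X - V X a \<in> K}"
  have "\<Union>K = (\<Union>b\<in>B. X - V X b)"
  proof
    show "\<Union>K \<subseteq> (\<Union>b\<in>B. X - V X b)"
    proof
      fix x assume "x \<in> \<Union>K"
      then obtain S where S: "S \<in> K" "x \<in> S" by blast
      then obtain a where a: "S = X - V X a" using K by (auto simp: tau_def)
      then have "a \<in> B" using S by (simp add: B_def)
      then show "x \<in> (\<Union>b\<in>B. X - V X b)" using a S by blast
    qed
    show "(\<Union>b\<in>B. X - V X b) \<subseteq> \<Union>K" unfolding B_def by blast
  qed
  also have "\<dots> = X - V X (Sup B)" by (rule V_Sup[symmetric])
  finally show "\<Union>K \<in> tau X" by (auto simp: tau_def)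
qed

lemma openin_V_topology:
  assumes "X_top_lattice X"
  shows "openin (V_topology X) U \<longleftrightarrow> U \<in> tau X"
  using istopology_tau[OF assms] by (simp add: V_topology_def topology_inverse')

lemma topspace_V_topology:
  assumes "top \<notin> X" "X_top_lattice X"
  shows "topspace (V_topology X) = X"
proof -
  have "X = X - V X top" using assms(1) by (auto simp: V_def top_unique)
  then have "X \<in> tau X" by (auto simp: tau_def)
  moreover have "U \<subseteq> X" if "U \<in> tau X" for U using that by (auto simp: tau_def)
  ultimately show ?thesis
    unfolding topspace_def openin_V_topology[OF assms(2)] by (intro equalityI) (blast, blast)
qed

lemma closedin_V_topology:
  assumes "top \<notin> X" "X_top_lattice X"
  shows "closedin (V_topology X) F \<longleftrightarrow> (\<exists>a. F = V X a)"
proof -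
  have sub: "V X a \<subseteq> X" for a by (auto simp: V_def)
  have "F \<subseteq> X \<and> X - F \<in> tau X \<longleftrightarrow> (\<exists>a. F = V X a)"
  proof
    assume "F \<subseteq> X \<and> X - F \<in> tau X"
    then obtain a where "F \<subseteq> X" "X - F = X - V X a" by (auto simp: tau_def)
    then have "F = V X a" using sub[of a] by blast
    then show "\<exists>a. F = V X a" ..
  next
    assume "\<exists>a. F = V X a"
    then show "F \<subseteq> X \<and> X - F \<in> tau X" using sub by (auto simp: tau_def)
  qed
  then show ?thesis
    by (simp add: closedin_def topspace_V_topology[OF assms] openin_V_topology[OF assms(2)])
qed

end

theory Submission
  imports Defs
begin

text \<open>
  All three correspondences are given by the same map \<open>V X\<close>. It forms, together with \<open>Inf\<close>, an
  antitone Galois connection between elements of the lattice and subsets of \<open>X\<close>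
  (\<open>subset_V_iff\<close>). The closed elements on the lattice side are the radical elements, those on
  the topological side are the closed sets, so \<open>V X\<close> is an order-reversing bijection between
  the two.

  Under this bijection, prime-like elements match irreducible sets. A point \<open>p\<close> of \<open>X\<close> is a
  generic point of \<open>V X p\<close>, the smallest closed set containing \<open>p\<close>, which is therefore
  irreducible. Conversely, the radical element of an irreducible closed set is strongly
  irreducible, because in an \<open>X\<close>-top lattice a meet of radical elements corresponds to the union
  of their closed sets (\<open>V_inf_radical_elements\<close>). The inclusion assumed in the last two
  parts turns this element into a generic point in \<open>X\<close>.

  Finally, an irreducible component is a maximal irreducible closed set, since the closure of an
  irreducible set is irreducible (\<open>irreducible_in_closure\<close>). As \<open>V X\<close> reverses the order,
  maximal irreducible closed sets correspond to minimal points.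
\<close>

lemma subset_V_iff:
  assumes "A \<subseteq> X"
  shows "A \<subseteq> V X c \<longleftrightarrow> c \<le> Inf A"
  using assms by (auto simp: V_def le_Inf_iff)

lemma V_subset: "V X a \<subseteq> X"
  by (auto simp: V_def)

lemma V_antimono: "a \<le> b \<Longrightarrow> V X b \<subseteq> V X a"
  by (auto simp: V_def)

lemma V_radical: "V X (radical X a) = V X a"
proof
  show "V X (radical X a) \<subseteq> V X a"
    using subset_V_iff[OF V_subset, of X a a] by (intro V_antimono) (simp add: radical_def)
  show "V X a \<subseteq> V X (radical X a)"
    by (simp add: subset_V_iff V_subset radical_def)
qed

lemma radical_in_radical_elements: "radical X a \<in> radical_elements X"
  using V_radical[of X a] by (simp add: radical_elements_def radical_def)

lemma V_subset_iff:
  assumes "a \<in> radical_elements X"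
  shows "V X a \<subseteq> V X b \<longleftrightarrow> b \<le> a"
  using assms by (simp add: subset_V_iff V_subset radical_elements_def radical_def)

lemma inj_on_V: "inj_on (V X) (radical_elements X)"
  by (rule inj_onI) (metis V_subset_iff order_antisym order_refl)

lemma subset_radical_elements: "X \<subseteq> radical_elements X"
proof
  fix p assume "p \<in> X"
  \<comment> \<open>The meet of \<open>V X p\<close> is attained at \<open>p\<close> itself.\<close>
  then have "Inf (V X p) = p" by (intro Inf_eqI) (auto simp: V_def)
  then show "p \<in> radical_elements X" by (simp add: radical_elements_def radical_def)
qed

text \<open>If the union of the two closed sets is \<open>V X d\<close>, then \<open>d\<close> lies below the meet of each of
  them, that is, below both \<open>a\<close> and \<open>b\<close>. For elements that are not radical the right-hand side
  can be strictly smaller.\<close>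

lemma V_inf_radical_elements:
  assumes "X_top_lattice X" "a \<in> radical_elements X" "b \<in> radical_elements X"
  shows "V X (inf a b) = V X a \<union> V X b"
proof
  show "V X a \<union> V X b \<subseteq> V X (inf a b)" by (auto simp: V_def le_infI1 le_infI2)
  have "\<Union>{V X a, V X b} \<in> {V X a | a. True}"
    by (rule assms(1)[unfolded X_top_lattice_def, rule_format]) blast
  then obtain d where d: "V X a \<union> V X b = V X d" by auto
  then have "V X a \<subseteq> V X d" "V X b \<subseteq> V X d" by auto
  then have "d \<le> inf a b" using assms(2,3) by (simp add: V_subset_iff)
  then show "V X (inf a b) \<subseteq> V X a \<union> V X b" unfolding d by (rule V_antimono)
qed

lemma bij_betw_V_closedin:
  assumes "top \<notin> X" "X_top_lattice X"
  shows "bij_betw (V X) (radical_elements X) {F. closedin (V_topology X) F}"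
proof -
  have "V X a \<in> V X ` radical_elements X" for a
    using V_radical[of X a] radical_in_radical_elements by (metis imageI)
  then show ?thesis
    using inj_on_V by (auto simp: bij_betw_def closedin_V_topology[OF assms])
qed

lemma irreducible_in_V_point:
  assumes "top \<notin> X" "X_top_lattice X" "p \<in> X"
  shows "irreducible_in (V_topology X) (V X p)"
proof -
  have "p \<in> V X p" using assms(3) by (simp add: V_def)
  \<comment> \<open>Whichever of the two closed sets contains the generic point contains its closure.\<close>
  moreover have "V X p \<subseteq> F" if "closedin (V_topology X) F" "p \<in> F" for F
    using that by (auto simp: closedin_V_topology[OF assms(1,2)] V_def)
  ultimately show ?thesis
    unfolding irreducible_in_def topspace_V_topology[OF assms(1,2)]
    using V_subset[of X p] by blast
qed

text \<open>The set \<open>V X (Inf A)\<close> is the closure of \<open>A\<close>: it lies in the same closed sets as \<open>A\<close>, and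
  irreducibility only depends on these.\<close>

lemma irreducible_in_closure:
  assumes "top \<notin> X" "X_top_lattice X" "irreducible_in (V_topology X) A"
  shows "A \<subseteq> V X (Inf A)" "irreducible_in (V_topology X) (V X (Inf A))"
proof -
  have AX: "A \<subseteq> X"
    using assms(3) by (simp add: irreducible_in_def topspace_V_topology[OF assms(1,2)])
  then show sub: "A \<subseteq> V X (Inf A)" by (simp add: subset_V_iff)
  have clos: "V X (Inf A) \<subseteq> F" if "closedin (V_topology X) F" "A \<subseteq> F" for F
    using that AX by (auto simp: closedin_V_topology[OF assms(1,2)] subset_V_iff
        dest: V_antimono[THEN subsetD])
  have irr: "A \<subseteq> F1 \<or> A \<subseteq> F2"
    if "closedin (V_topology X) F1" "closedin (V_topology X) F2" "A \<subseteq> F1 \<union> F2" for F1 F2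
    using assms(3) that unfolding irreducible_in_def by blast
  have "A \<noteq> {}" using assms(3) by (simp add: irreducible_in_def)
  with sub have "V X (Inf A) \<noteq> {}" by blast
  moreover have "V X (Inf A) \<subseteq> F1 \<or> V X (Inf A) \<subseteq> F2"
    if "closedin (V_topology X) F1" "closedin (V_topology X) F2" "V X (Inf A) \<subseteq> F1 \<union> F2"
    for F1 F2
    using irr[OF that(1,2)] clos[OF that(1)] clos[OF that(2)] that(3) sub by blast
  ultimately show "irreducible_in (V_topology X) (V X (Inf A))"
    unfolding irreducible_in_def topspace_V_topology[OF assms(1,2)]
    using V_subset[of X "Inf A"] by blast
qed

lemma strongly_irreducible_if_irreducible_in_V:
  assumes "top \<notin> X" "X_top_lattice X" "a \<in> radical_elements X"
    and "irreducible_in (V_topology X) (V X a)"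
  shows "a \<in> strongly_irreducible_elements (radical_elements X)"
proof -
  \<comment> \<open>No point of \<open>X\<close> lies above \<open>top\<close>, whereas irreducible sets are non-empty.\<close>
  have "a \<noteq> top"
    using assms(1,4) by (auto simp: irreducible_in_def V_def top_unique)
  moreover have "b \<le> a \<or> c \<le> a"
    if b: "b \<in> radical_elements X" and c: "c \<in> radical_elements X" and "inf b c \<le> a" for b c
  proof -
    have "V X a \<subseteq> V X b \<union> V X c"
      using V_antimono[OF \<open>inf b c \<le> a\<close>] V_inf_radical_elements[OF assms(2) b c] by blast
    moreover have "closedin (V_topology X) (V X b)" "closedin (V_topology X) (V X c)"
      by (auto simp: closedin_V_topology[OF assms(1,2)])
    ultimately have "V X a \<subseteq> V X b \<or> V X a \<subseteq> V X c"
      using assms(4) unfolding irreducible_in_def by blast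
    then show ?thesis using assms(3) by (simp add: V_subset_iff)
  qed
  ultimately show ?thesis using assms(3) by (simp add: strongly_irreducible_elements_def)
qed

text \<open>Sobriety of the space: the generic point is the radical of \<open>a\<close>, which belongs to \<open>X\<close>
  because it is strongly irreducible.\<close>

lemma irreducible_closed_generic_point:
  assumes "top \<notin> X" "X_top_lattice X"
    and "strongly_irreducible_elements (radical_elements X) \<subseteq> X"
    and "irreducible_in (V_topology X) (V X a)"
  obtains p where "p \<in> X" "V X a = V X p"
proof
  show "V X a = V X (radical X a)" by (simp add: V_radical)
  with assms(4) have "irreducible_in (V_topology X) (V X (radical X a))" by simp
  from strongly_irreducible_if_irreducible_in_V[OF assms(1,2) radical_in_radical_elements this]
  show "radical X a \<in> X" using assms(3) by blast
qed

lemma bij_betw_V_irreducible_closed: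
  assumes "top \<notin> X" "X_top_lattice X"
    and "strongly_irreducible_elements (radical_elements X) \<subseteq> X"
  shows "bij_betw (V X) X {F. closedin (V_topology X) F \<and> irreducible_in (V_topology X) F}"
proof -
  have "V X ` X = {F. closedin (V_topology X) F \<and> irreducible_in (V_topology X) F}"
  proof (intro equalityI subsetI)
    fix F assume "F \<in> V X ` X"
    then show "F \<in> {F. closedin (V_topology X) F \<and> irreducible_in (V_topology X) F}"
      using irreducible_in_V_point[OF assms(1,2)]
      by (auto simp: closedin_V_topology[OF assms(1,2)])
  next
    fix F assume "F \<in> {F. closedin (V_topology X) F \<and> irreducible_in (V_topology X) F}"
    then obtain a where "F = V X a" "irreducible_in (V_topology X) (V X a)"
      by (auto simp: closedin_V_topology[OF assms(1,2)])
    then show "F \<in> V X ` X"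
      using irreducible_closed_generic_point[OF assms] by (metis imageI)
  qed
  then show ?thesis
    using inj_on_subset[OF inj_on_V subset_radical_elements] by (simp add: bij_betw_def)
qed

text \<open>Irreducible sets need not be closed, but each one lies in \<open>V X q\<close> for a point \<open>q\<close>, so the
  sets \<open>V X q\<close> suffice to test maximality.\<close>

lemma irreducible_in_subset_V_point:
  assumes "top \<notin> X" "X_top_lattice X"
    and "strongly_irreducible_elements (radical_elements X) \<subseteq> X"
    and "irreducible_in (V_topology X) B"
  obtains q where "q \<in> X" "B \<subseteq> V X q"
proof -
  obtain q where "q \<in> X" "V X (Inf B) = V X q"
    using irreducible_closed_generic_point[OF assms(1-3) irreducible_in_closure(2)[OF assms(1,2,4)]] .
  then show thesis using that irreducible_in_closure(1)[OF assms(1,2,4)] by simp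
qed

lemma bij_betw_V_irreducible_components:
  assumes "top \<notin> X" "X_top_lattice X"
    and "strongly_irreducible_elements (radical_elements X) \<subseteq> X"
  shows "bij_betw (V X) (minimal_elements X) {A. irreducible_component_of (V_topology X) A}"
proof -
  have V_le: "V X p \<subseteq> V X q \<longleftrightarrow> q \<le> p" if "p \<in> X" for p q
    using V_subset_iff subset_radical_elements that by blast
  note irr = irreducible_in_V_point[OF assms(1,2)]
  have "irreducible_component_of (V_topology X) (V X p)" if p: "p \<in> minimal_elements X" for p
  proof -
    have pX: "p \<in> X" using p by (simp add: minimal_elements_def)
    have False if B: "irreducible_in (V_topology X) B" "V X p \<subset> B" for B
    proof -
      obtain q where q: "q \<in> X" "B \<subseteq> V X q"
        using irreducible_in_subset_V_point[OF assms B(1)] .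
      then have "q \<le> p" using B(2) V_le[OF pX] by blast
      then have "q = p" using p q(1) by (simp add: minimal_elements_def)
      then show False using B(2) q(2) by blast
    qed
    then show ?thesis using irr[OF pX] by (auto simp: irreducible_component_of_def)
  qed
  moreover have "A \<in> V X ` minimal_elements X"
    if A: "irreducible_component_of (V_topology X) A" for A
  proof -
    have max: "A = B" if "irreducible_in (V_topology X) B" "A \<subseteq> B" for B
      using A that unfolding irreducible_component_of_def by blast
    have "irreducible_in (V_topology X) A" using A by (simp add: irreducible_component_of_def)
    then obtain p where p: "p \<in> X" "A \<subseteq> V X p"
      using irreducible_in_subset_V_point[OF assms] by blast
    have Ap: "A = V X p" using max[OF irr[OF p(1)] p(2)] .
    have "q = p" if "q \<in> X" "q \<le> p" for q
    proof -
      have "A \<subseteq> V X q" using that(2) V_le[OF p(1)] Ap by blast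
      then have "V X q \<subseteq> V X p" using max[OF irr[OF that(1)]] Ap by blast
      then show ?thesis using that V_le by (blast intro: order_antisym)
    qed
    then have "p \<in> minimal_elements X" using p(1) by (simp add: minimal_elements_def)
    then show ?thesis using Ap by blast
  qed
  moreover have "minimal_elements X \<subseteq> radical_elements X"
    using subset_radical_elements by (auto simp: minimal_elements_def)
  ultimately show ?thesis
    using inj_on_subset[OF inj_on_V] unfolding bij_betw_def by blast
qed

theorem theorem2p6:
  fixes X :: "'a::complete_lattice set"
  assumes "X \<subseteq> UNIV - {top}"
    and "X_top_lattice X"
  shows "(\<exists>f. bij_betw f (radical_elements X) {F. closedin (V_topology X) F}) \<and>
    (strongly_irreducible_elements (radical_elements X) \<subseteq> X \<longrightarrow>
      (\<exists>f. bij_betw f X {F. closedin (V_topology X) F \<and> irreducible_in (V_topology X) F})) \<and>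
    (strongly_irreducible_elements (radical_elements X) \<subseteq> X \<longrightarrow>
      (\<exists>f. bij_betw f (minimal_elements X) {A. irreducible_component_of (V_topology X) A}))"
proof -
  have top: "top \<notin> X" using assms(1) by blast
  show ?thesis
    by (intro conjI impI exI[of _ "V X"] bij_betw_V_closedin[OF top assms(2)]
        bij_betw_V_irreducible_closed[OF top assms(2)]
        bij_betw_V_irreducible_components[OF top assms(2)])
qed

end
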